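(* Let $\Pi\in S_n$ be a permutation, let $G'=\Pi(G)$, and let $\mathcal{W}'=\{\Pi\Psi_j\Pi^T,\Pi\Phi\Pi^T\}_{j\in\mathcal{J}}$ be the corresponding transform on $G'$. Then, for all $\mathbf{x}\in\mathbf{L}^2(\mathbf{M})$, $$\mathbf{U}'\Pi\mathbf{x}=\Pi\mathbf{U}\mathbf{x}\qquad\text{and}\qquad\mathbf{S}'\Pi\mathbf{x}=\Pi\mathbf{S}\mathbf{x},$$ where $\Pi$ acts on a family of vectors elementwise.
   Context: $G$ is a weighted connected graph with vertices $\{0,\dots,n-1\}$; $\mathbf{M}$ is an invertible real $n\times n$ matrix; $\mathbf{L}^2(\mathbf{M})$ is $\mathbb{R}^n$ with norm $\|\mathbf{x}\|_{\mathbf{M}}=\|\mathbf{M}\mathbf{x}\|_2$. $\mathcal{J}$ is a countable index set and $\mathcal{W}=\{\Psi_j,\Phi\}_{j\in\mathcal{J}}$ is a family of $n\times n$ matrices that is a frame on $\mathbf{L}^2(\mathbf{M})$, i.e. for some $0<c\le C<\infty$, $c\|\mathbf{x}\|_{\mathbf{M}}^2\le\sum_{j}\|\Psi_j\mathbf{x}\|_{\mathbf{M}}^2+\|\Phi\mathbf{x}\|_{\mathbf{M}}^2\le C\|\mathbf{x}\|_{\mathbf{M}}^2$ for all $\mathbf{x}$. A permutation $\Pi\in S_n$ is identified with its permutation matrix; $\Pi(G)$ is the graph obtained by permuting the vertices of $G$. Let $M$ denote the entrywise absolute value on $\mathbb{R}^n$. For a path $\mathbf{p}=(j_1,\dots,j_m)\in\mathcal{J}^m$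 set $\mathbf{U}[\mathbf{p}]\mathbf{x}=M\Psi_{j_m}\cdots M\Psi_{j_1}\mathbf{x}$ (for the empty path, $m=0$, $\mathbf{U}[\mathbf{p}]\mathbf{x}=\mathbf{x}$) and $\mathbf{S}[\mathbf{p}]\mathbf{x}=\Phi\mathbf{U}[\mathbf{p}]\mathbf{x}$. $\mathbf{U}\mathbf{x}=\{\mathbf{U}[\mathbf{p}]\mathbf{x}\}_{\mathbf{p}}$ and $\mathbf{S}\mathbf{x}=\{\mathbf{S}[\mathbf{p}]\mathbf{x}\}_{\mathbf{p}}$, indexed by all paths of all lengths $m\ge0$. $\mathbf{U}'$ and $\mathbf{S}'$ are defined in the same way from $\mathcal{W}'$ (i.e. with $\Psi_j'=\Pi\Psi_j\Pi^T$ and $\Phi'=\Pi\Phi\Pi^T$). *)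

theory Defs
  imports
    "HOL-Analysis.Analysis"
    "HOL-Combinatorics.Permutations"
    "Graph_Theory.Pair_Digraph"
    "Graph_Theory.Digraph_Component"
    "Graph_Theory.Weighted_Graph"
begin

text \<open>
  The vertices \<open>{0,\<dots>,n-1}\<close> are the elements of a finite index type \<open>'n\<close>, so that
  \<open>n = CARD('n)\<close>. A weighted graph is a pair of a finite simple undirected graph
  (the locale \<open>pair_graph\<close>, whose edges are symmetric sets of ordered pairs) and a weight
  function on its arcs. The constant \<open>connected\<close> of the graph library is written with its
  qualified name, since it shares its base name with topological connectedness.
\<close>

definition weighted_connected_graph ::
    "('n::finite) pair_pre_digraph \<Rightarrow> ('n \<times> 'n) weight_fun \<Rightarrow> bool" where
  "weighted_connected_graph G w \<longleftrightarrow>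
     pair_graph G \<and> pverts G = UNIV \<and> Digraph_Component.connected (with_proj G) \<and>
     (\<forall>(u, v) \<in> parcs G. w (u, v) > 0 \<and> w (v, u) = w (u, v))"

definition permute_graph :: "('n \<Rightarrow> 'n) \<Rightarrow> 'n pair_pre_digraph \<Rightarrow> 'n pair_pre_digraph" where
  "permute_graph \<pi> G = \<lparr> pverts = \<pi> ` pverts G, parcs = map_prod \<pi> \<pi> ` parcs G \<rparr>"

definition permute_weight :: "('n \<Rightarrow> 'n) \<Rightarrow> ('n \<times> 'n) weight_fun \<Rightarrow> ('n \<times> 'n) weight_fun" where
  "permute_weight \<pi> w = w \<circ> map_prod (inv \<pi>) (inv \<pi>)"

text \<open>
  The convention is \<open>\<Pi> e\<^sub>j = e\<^bsub>\<pi>(j)\<^esub>\<close>, which agrees with \<open>permute_graph\<close>: if \<open>A\<close> is the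
  (weighted) adjacency matrix of a graph then \<open>\<Pi> A \<Pi>\<^sup>T\<close> is that of the permuted graph.
\<close>

definition perm_matrix :: "('n::finite \<Rightarrow> 'n) \<Rightarrow> real^'n^'n" where
  "perm_matrix \<pi> = (\<chi> i j. if i = \<pi> j then 1 else 0)"

definition norm_M :: "real^'n^'n \<Rightarrow> real^'n \<Rightarrow> real" where
  "norm_M M x = norm (M *v x)"

text \<open>
  \<open>infsum\<close> is \<open>0\<close> on families that are not summable, so convergence of the series, which the
  finite upper bound entails for a sum of nonnegative terms, is required explicitly.
\<close>

definition frame_on_L2 ::
    "real^'n^'n \<Rightarrow> 'j set \<Rightarrow> ('j \<Rightarrow> real^'n^'n) \<Rightarrow> real^'n^'n \<Rightarrow> bool" where
  "frame_on_L2 M J \<Psi> \<Phi> \<longleftrightarrow>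
     (\<exists>c C. 0 < c \<and> c \<le> C \<and>
       (\<forall>x. (\<lambda>j. (norm_M M (\<Psi> j *v x))\<^sup>2) summable_on J \<and>
            c * (norm_M M x)\<^sup>2
              \<le> (\<Sum>\<^sub>\<infinity>j\<in>J. (norm_M M (\<Psi> j *v x))\<^sup>2) + (norm_M M (\<Phi> *v x))\<^sup>2 \<and>
            (\<Sum>\<^sub>\<infinity>j\<in>J. (norm_M M (\<Psi> j *v x))\<^sup>2) + (norm_M M (\<Phi> *v x))\<^sup>2
              \<le> C * (norm_M M x)\<^sup>2))"

text \<open>
  A path \<open>(j\<^sub>1,\<dots>,j\<^sub>m)\<close> is the list \<open>[j\<^sub>1,\<dots>,j\<^sub>m]\<close> over \<open>J\<close>; its first entry acts first.
  The absolute value \<open>\<bar>_\<bar>\<close> on \<open>real^'n\<close> is the entrywise one (\<open>abs_vec_def\<close>).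
  The families \<open>U x\<close> and \<open>S x\<close> are functions on \<open>lists J\<close>, the set of all paths of all
  lengths, extended by \<open>undefined\<close> to other lists, so that equality of such functions is
  equality of families indexed by the paths.
\<close>

primrec U_path :: "('j \<Rightarrow> real^'n^'n) \<Rightarrow> 'j list \<Rightarrow> real^'n \<Rightarrow> real^'n" where
  "U_path \<Psi> [] x = x"
| "U_path \<Psi> (j # p) x = U_path \<Psi> p \<bar>\<Psi> j *v x\<bar>"

definition S_path ::
    "('j \<Rightarrow> real^'n^'n) \<Rightarrow> real^'n^'n \<Rightarrow> 'j list \<Rightarrow> real^'n \<Rightarrow> real^'n" where
  "S_path \<Psi> \<Phi> p x = \<Phi> *v U_path \<Psi> p x"

definition U_family ::
    "'j set \<Rightarrow> ('j \<Rightarrow> real^'n^'n) \<Rightarrow> real^'n \<Rightarrow> 'j list \<Rightarrow> real^'n" where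
  "U_family J \<Psi> x = (\<lambda>p\<in>lists J. U_path \<Psi> p x)"

definition S_family ::
    "'j set \<Rightarrow> ('j \<Rightarrow> real^'n^'n) \<Rightarrow> real^'n^'n \<Rightarrow> real^'n \<Rightarrow> 'j list \<Rightarrow> real^'n" where
  "S_family J \<Psi> \<Phi> x = (\<lambda>p\<in>lists J. S_path \<Psi> \<Phi> p x)"

definition act_elementwise ::
    "'j set \<Rightarrow> real^'n^'n \<Rightarrow> ('j list \<Rightarrow> real^'n) \<Rightarrow> 'j list \<Rightarrow> real^'n" where
  "act_elementwise J A F = (\<lambda>p\<in>lists J. A *v F p)"

end

theory Submission
  imports Defs
begin

text \<open>
  A permutation matrix commutes with the entrywise absolute value and intertwines
  \<open>\<Psi>\<^sub>j\<close> with \<open>\<Pi> \<Psi>\<^sub>j \<Pi>\<^sup>T\<close> because \<open>\<Pi>\<^sup>T \<Pi> = I\<close>; hence it can be moved through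
  every layer of the cascade, one path entry at a time.
\<close>

lemma perm_matrix_vector_nth:
  assumes "\<pi> permutes UNIV"
  shows "(perm_matrix \<pi> *v x) $ i = x $ inv \<pi> i"
proof -
  \<comment> \<open>Solving for the summation index \<open>j\<close> lets \<open>simp\<close>
    collapse the row sum to its one nonzero term.\<close>
  have "(i = \<pi> j) = (j = inv \<pi> i)" for j
    using permutes_inv_eq[OF assms] by metis
  then show ?thesis
    by (simp add: perm_matrix_def matrix_vector_mult_def if_distrib[of "\<lambda>a. a * _"] cong: if_cong)
qed

lemma transpose_perm_matrix_vector_nth:
  "(transpose (perm_matrix \<pi>) *v x) $ i = x $ \<pi> i"
  by (simp add: perm_matrix_def transpose_def matrix_vector_mult_def
      if_distrib[of "\<lambda>a. a * _"] cong: if_cong)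

lemma transpose_perm_matrix_inverse:
  assumes "\<pi> permutes UNIV"
  shows "transpose (perm_matrix \<pi>) *v (perm_matrix \<pi> *v x) = x"
  \<comment> \<open>The simp rule \<open>transpose_matrix_vector\<close> would turn the product into
    \<open>v*\<close> form, which the coordinate lemma does not match.\<close>
  by (simp add: vec_eq_iff transpose_perm_matrix_vector_nth perm_matrix_vector_nth[OF assms]
      permutes_inverses[OF assms] del: transpose_matrix_vector)

lemma conjugate_perm_matrix_vector:
  assumes "\<pi> permutes UNIV"
  shows "(perm_matrix \<pi> ** A ** transpose (perm_matrix \<pi>)) *v (perm_matrix \<pi> *v x)
    = perm_matrix \<pi> *v (A *v x)"
  by (simp only: matrix_vector_mul_assoc[symmetric] transpose_perm_matrix_inverse[OF assms])

text \<open>Each coordinate of the image is a single coordinate of \<open>x\<close>, so no sum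
  stands under the absolute value; a general orthogonal matrix lacks this property.\<close>

lemma abs_perm_matrix_vector:
  assumes "\<pi> permutes UNIV"
  shows "\<bar>perm_matrix \<pi> *v x\<bar> = perm_matrix \<pi> *v \<bar>x\<bar>"
  by (simp add: vec_eq_iff abs_vec_def perm_matrix_vector_nth[OF assms])

lemma U_path_perm_matrix:
  assumes "\<pi> permutes UNIV"
    and "\<And>j. j \<in> J \<Longrightarrow> \<Psi>' j = perm_matrix \<pi> ** \<Psi> j ** transpose (perm_matrix \<pi>)"
    and "p \<in> lists J"
  shows "U_path \<Psi>' p (perm_matrix \<pi> *v x) = perm_matrix \<pi> *v U_path \<Psi> p x"
  using assms(3)
  \<comment> \<open>The head of a path acts first, so the induction hypothesis is needed at
    \<open>\<bar>\<Psi> j *v x\<bar>\<close> rather than at \<open>x\<close>.\<close>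
  by (induction p arbitrary: x)
    (simp_all add: assms(2) conjugate_perm_matrix_vector[OF assms(1)]
      abs_perm_matrix_vector[OF assms(1)])

theorem theorem3p6:
  fixes G G' :: "('n::finite) pair_pre_digraph"
    and w w' :: "('n \<times> 'n) weight_fun"
    and M :: "real^'n^'n"
    and J :: "'j set"
    and \<Psi> \<Psi>' :: "'j \<Rightarrow> real^'n^'n"
    and \<Phi> \<Phi>' :: "real^'n^'n"
    and \<pi> :: "'n \<Rightarrow> 'n"
    and P :: "real^'n^'n"
  assumes "weighted_connected_graph G w"
    and "invertible M"
    and "countable J"
    and "frame_on_L2 M J \<Psi> \<Phi>"
    and "\<pi> permutes UNIV"
    and "P = perm_matrix \<pi>"
    and "G' = permute_graph \<pi> G"
    and "w' = permute_weight \<pi> w"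
    and "\<And>j. j \<in> J \<Longrightarrow> \<Psi>' j = P ** \<Psi> j ** transpose P"
    and "\<Phi>' = P ** \<Phi> ** transpose P"
  shows "\<forall>x. U_family J \<Psi>' (P *v x) = act_elementwise J P (U_family J \<Psi> x) \<and>
             S_family J \<Psi>' \<Phi>' (P *v x) = act_elementwise J P (S_family J \<Psi> \<Phi> x)"
proof (intro allI conjI)
  fix x
  have U: "U_path \<Psi>' p (P *v x) = P *v U_path \<Psi> p x" if "p \<in> lists J" for p
    unfolding assms(6)
    by (rule U_path_perm_matrix) (use that assms(5,6,9) in auto)
  \<comment> \<open>Both families are \<open>undefined\<close> off \<open>lists J\<close>, so
    \<open>restrict_ext\<close> leaves only paths over \<open>J\<close> to compare.\<close>
  show "U_family J \<Psi>' (P *v x) = act_elementwise J P (U_family J \<Psi> x)"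
    unfolding U_family_def act_elementwise_def by (rule restrict_ext) (simp add: U)
  have S: "S_path \<Psi>' \<Phi>' p (P *v x) = P *v S_path \<Psi> \<Phi> p x" if "p \<in> lists J" for p
    \<comment> \<open>Once \<open>P\<close> has passed through the cascade, the same cancellation is
      applied with \<open>\<Phi>\<close> as the conjugated matrix.\<close>
    unfolding S_path_def U[OF that] unfolding assms(6,10)
    by (rule conjugate_perm_matrix_vector[OF assms(5)])
  show "S_family J \<Psi>' \<Phi>' (P *v x) = act_elementwise J P (S_family J \<Psi> \<Phi> x)"
    unfolding S_family_def act_elementwise_def by (rule restrict_ext) (simp add: S)
qed

end
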